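(* Let $\{P_\theta\}_{\theta\in\Theta}$ be a family of probability measures on a measurable space $(\Omega,\mathcal{F})$ with a filtration $(\mathcal{F}_t)_{t\ge 0}$ ($t\in\{0,1,2,\dots\}$), where $\Theta$ is partitioned into $\Theta_0$ (null) and $\Theta_1$ (alternative). Let $(\mathcal{S}_t)_{t\ge0}$ be a sufficient filtration for $\Theta$ satisfying $\mathcal{S}_t\subseteq\mathcal{F}_t$ for all $t\ge 0$. Let $(E_t)_{t\ge0}$ be an e-process for $\Theta_0$ with respect to $(\mathcal{F}_t)$ and define $G_t=\mathbb{E}_\Theta[E_t\mid\mathcal{S}_t]$. Then: (i) $(G_t)$ is an e-process for $\Theta_0$ with respect to $(\mathcal{S}_t)$; (ii) for all $\theta\in\Theta$, $\mathbb{E}_\theta[f(G_\tau)]\ge\mathbb{E}_\theta[f(E_\tau)]$ for all $(\mathcal{S}_t)$-stopping times $\tau$ and all concave utility functions $f$, provided both sides of the inequality are defined. Moreover, $\mathbb{E}_\theta[\log(E_\tau/G_\tau)]\le 0$ for any $\theta\in\Theta$ and any $(\mathcal{S}_t)$-stopping time $\tau$.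
   Context: Random variables are measurable functions on $\Omega$ with values in $[-\infty,\infty]$; $\mathbb{E}_\theta$ denotes expectation under $P_\theta$. The expectation $\mathbb{E}[Y]$ is defined as an element of $[-\infty,\infty]$ if $\mathbb{E}[Y^+]$ or $\mathbb{E}[Y^-]$ is finite; generalized conditional expectations then exist (in particular for all $Y\ge 0$). An e-variable for $\Theta_0$ is a $[0,\infty]$-valued random variable $E$ with $\mathbb{E}_\theta[E]\le 1$ for all $\theta\in\Theta_0$. Given a filtration $(\mathcal{H}_t)_{t\ge0}$, an $(\mathcal{H}_t)$-stopping time is a $\{0,1,2,\dots\}$-valued random variable $\tau$ with $\{\tau=t\}\in\mathcal{H}_t$ for all $t\ge0$. An e-process for $\Theta_0$ with respect to $(\mathcal{H}_t)$ is a sequence $(E_t)_{t\ge0}$ of nonnegative ($[0,\infty]$-valued) random variables such that $E_t$ is $\mathcal{H}_t$-measurable for all $t$ and $E_\tau$ is an e-variable for $\Theta_0$ for every $(\mathcal{H}_t)$-stopping time $\tau$. A filtration $(\mathcal{S}_t)$ with $\mathcal{S}_t\subseteq\mathcal{F}_t$ is sufficient for $\Theta$ if for each $t$ and every $\mathcal{F}_t$-measurable random variable $h$ there is a single $\mathcal{S}_t$-measurable random variable, denoted $\mathbb{E}_\Theta[h\mid\mathcal{S}_t]$, which is a version of $\mathbb{E}_\theta[h\mid\mathcal{S}_t]$ for every $\theta\in\Theta$, whenever these conditional expectations exist (in particular whenever $h\ge0$). A concave utility function is a concave function $f:(0,\infty)\to\mathbb{R}$, extended to $f:[0,\infty]\to[-\infty,\infty]$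 by $f(0):=\lim_{x\downarrow 0}f(x)$ and $f(\infty):=\lim_{x\to\infty}f(x)$. Ratios use the conventions $0/0=0$ and $\infty/\infty=1$; also $\log 0=-\infty$, $\log\infty=\infty$. *)

theory Defs
  imports "HOL-Probability.Probability"
begin

text \<open>
  Expectations of \<open>[-\<infinity>,\<infinity>]\<close>-valued random variables. Since \<^const>\<open>e2ennreal\<close> sends negative
  values to \<open>0\<close>, \<open>e2ennreal (Y \<omega>)\<close> and \<open>e2ennreal (- Y \<omega>)\<close> are the positive and negative part.
\<close>

definition expect_defined :: "'a measure \<Rightarrow> ('a \<Rightarrow> ereal) \<Rightarrow> bool" where
  "expect_defined M Y \<longleftrightarrow>
     (\<integral>\<^sup>+\<omega>. e2ennreal (Y \<omega>) \<partial>M) < \<infinity> \<or> (\<integral>\<^sup>+\<omega>. e2ennreal (- Y \<omega>) \<partial>M) < \<infinity>"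

definition expect :: "'a measure \<Rightarrow> ('a \<Rightarrow> ereal) \<Rightarrow> ereal" where
  "expect M Y =
     enn2ereal (\<integral>\<^sup>+\<omega>. e2ennreal (Y \<omega>) \<partial>M) - enn2ereal (\<integral>\<^sup>+\<omega>. e2ennreal (- Y \<omega>) \<partial>M)"

text \<open>
  \<open>g\<close> is a version of the generalized conditional expectation of \<open>h\<close> given \<open>S\<close>, i.e. of the
  difference of the conditional expectations of the positive and the negative part. It is used
  only if \<open>expect_defined M h\<close>; then at least one of the two is almost surely finite.
\<close>

definition is_cond_exp :: "'a measure \<Rightarrow> 'a measure \<Rightarrow> ('a \<Rightarrow> ereal) \<Rightarrow> ('a \<Rightarrow> ereal) \<Rightarrow> bool" where
  "is_cond_exp M S h g \<longleftrightarrow>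
     g \<in> borel_measurable S \<and>
     (AE \<omega> in M. g \<omega> = enn2ereal (nn_cond_exp M S (\<lambda>\<omega>. e2ennreal (h \<omega>)) \<omega>)
                      - enn2ereal (nn_cond_exp M S (\<lambda>\<omega>. e2ennreal (- h \<omega>)) \<omega>))"

definition is_common_cond_exp ::
  "('i \<Rightarrow> 'a measure) \<Rightarrow> 'i set \<Rightarrow> 'a measure \<Rightarrow> ('a \<Rightarrow> ereal) \<Rightarrow> ('a \<Rightarrow> ereal) \<Rightarrow> bool" where
  "is_common_cond_exp P \<Theta> S h g \<longleftrightarrow>
     g \<in> borel_measurable S \<and> (\<forall>\<theta>\<in>\<Theta>. is_cond_exp (P \<theta>) S h g)"

definition sufficient_filtration ::
  "'a measure \<Rightarrow> ('i \<Rightarrow> 'a measure) \<Rightarrow> 'i set \<Rightarrow> (nat \<Rightarrow> 'a measure) \<Rightarrow> (nat \<Rightarrow> 'a measure) \<Rightarrow> bool" where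
  "sufficient_filtration M P \<Theta> F S \<longleftrightarrow>
     filtration (space M) S \<and> (\<forall>t. subalgebra (F t) (S t)) \<and>
     (\<forall>t. \<forall>h \<in> borel_measurable (F t).
        (\<forall>\<theta>\<in>\<Theta>. expect_defined (P \<theta>) h) \<longrightarrow> (\<exists>g. is_common_cond_exp P \<Theta> (S t) h g))"

definition e_variable ::
  "'a measure \<Rightarrow> ('i \<Rightarrow> 'a measure) \<Rightarrow> 'i set \<Rightarrow> ('a \<Rightarrow> ennreal) \<Rightarrow> bool" where
  "e_variable M P \<Theta>0 X \<longleftrightarrow> X \<in> borel_measurable M \<and> (\<forall>\<theta>\<in>\<Theta>0. (\<integral>\<^sup>+\<omega>. X \<omega> \<partial>P \<theta>) \<le> 1)"

definition e_process ::
  "'a measure \<Rightarrow> ('i \<Rightarrow> 'a measure) \<Rightarrow> 'i set \<Rightarrow> (nat \<Rightarrow> 'a measure) \<Rightarrow> (nat \<Rightarrow> 'a \<Rightarrow> ennreal) \<Rightarrow> bool"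
  where
  "e_process M P \<Theta>0 H E \<longleftrightarrow>
     (\<forall>t. E t \<in> borel_measurable (H t)) \<and>
     (\<forall>\<tau>. stopping_time H \<tau> \<longrightarrow> e_variable M P \<Theta>0 (\<lambda>\<omega>. E (\<tau> \<omega>) \<omega>))"

text \<open>
  Extension to \<open>[0,\<infinity>]\<close> of a concave function \<open>f\<close> on \<open>(0,\<infinity>)\<close>; values of \<open>f\<close> outside \<open>(0,\<infinity>)\<close> are
  not used. For concave \<open>f\<close> both limits exist in \<open>[-\<infinity>,\<infinity>]\<close>, because \<open>f\<close> is monotone near each
  endpoint.
\<close>

definition extend_utility :: "(real \<Rightarrow> real) \<Rightarrow> ennreal \<Rightarrow> ereal" where
  "extend_utility f x =
     (if x = 0 then Lim (at_right 0) (\<lambda>r. ereal (f r))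
      else if x = \<infinity> then Lim at_top (\<lambda>r. ereal (f r))
      else ereal (f (enn2real x)))"

definition ext_ln :: "ennreal \<Rightarrow> ereal" where
  "ext_ln x = (if x = 0 then - \<infinity> else if x = \<infinity> then \<infinity> else ereal (ln (enn2real x)))"

text \<open>The library division on \<^typ>\<open>ennreal\<close> has \<open>0 / 0 = 0\<close> but also \<open>\<infinity> / \<infinity> = 0\<close>.\<close>

definition e_ratio :: "ennreal \<Rightarrow> ennreal \<Rightarrow> ennreal" where
  "e_ratio x y = (if x = \<infinity> \<and> y = \<infinity> then 1 else x / y)"

text \<open>In discrete time, \<^const>\<open>stopping_time\<close> can be expressed through the events \<open>\<tau> = t\<close>.\<close>

lemma stopping_time_nat_iff:
  fixes H :: "nat \<Rightarrow> 'a measure" and \<tau> :: "'a \<Rightarrow> nat"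
  assumes "filtration \<Omega> H"
  shows "stopping_time H \<tau> \<longleftrightarrow> (\<forall>t. {\<omega>\<in>\<Omega>. \<tau> \<omega> = t} \<in> sets (H t))"
proof -
  interpret filtration \<Omega> H by fact
  have le_iff: "stopping_time H \<tau> \<longleftrightarrow> (\<forall>t. {\<omega>\<in>\<Omega>. \<tau> \<omega> \<le> t} \<in> sets (H t))"
    by (simp add: stopping_time_def pred_def space_F)
  show ?thesis
  proof
    assume "stopping_time H \<tau>"
    then have le: "{\<omega>\<in>\<Omega>. \<tau> \<omega> \<le> t} \<in> sets (H t)" for t by (simp add: le_iff)
    show "\<forall>t. {\<omega>\<in>\<Omega>. \<tau> \<omega> = t} \<in> sets (H t)"
    proof
      fix t
      show "{\<omega>\<in>\<Omega>. \<tau> \<omega> = t} \<in> sets (H t)"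
      proof (cases t)
        case 0
        then show ?thesis using le[of 0] by simp
      next
        case (Suc s)
        have "{\<omega>\<in>\<Omega>. \<tau> \<omega> \<le> s} \<in> sets (H t)"
          using le[of s] sets_F_mono[of s t] Suc by auto
        then have "{\<omega>\<in>\<Omega>. \<tau> \<omega> \<le> t} - {\<omega>\<in>\<Omega>. \<tau> \<omega> \<le> s} \<in> sets (H t)"
          using le[of t] by blast
        also have "{\<omega>\<in>\<Omega>. \<tau> \<omega> \<le> t} - {\<omega>\<in>\<Omega>. \<tau> \<omega> \<le> s} = {\<omega>\<in>\<Omega>. \<tau> \<omega> = t}"
          using Suc by auto
        finally show ?thesis .
      qed
    qed
  next
    assume eq: "\<forall>t. {\<omega>\<in>\<Omega>. \<tau> \<omega> = t} \<in> sets (H t)"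
    show "stopping_time H \<tau>"
      unfolding le_iff
    proof
      fix t
      have "(\<Union>s\<in>{..t}. {\<omega>\<in>\<Omega>. \<tau> \<omega> = s}) \<in> sets (H t)"
        using eq sets_F_mono[of _ t] by (intro sets.finite_UN) auto
      also have "(\<Union>s\<in>{..t}. {\<omega>\<in>\<Omega>. \<tau> \<omega> = s}) = {\<omega>\<in>\<Omega>. \<tau> \<omega> \<le> t}"
        by auto
      finally show "{\<omega>\<in>\<Omega>. \<tau> \<omega> \<le> t} \<in> sets (H t)" .
    qed
  qed
qed

text \<open>
  For nonnegative \<open>E\<close>, sufficiency yields a common version of the conditional expectations with
  values in \<open>[0,\<infinity>]\<close>.
\<close>

lemma sufficient_filtration_nonneg_version:
  assumes suff: "sufficient_filtration M P \<Theta> F S"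
    and prob: "\<And>\<theta>. \<theta> \<in> \<Theta> \<Longrightarrow> prob_space (P \<theta>)" "\<And>\<theta>. \<theta> \<in> \<Theta> \<Longrightarrow> sets (P \<theta>) = sets M"
    and sub: "subalgebra M (F t)"
    and E: "E \<in> borel_measurable (F t)"
  shows "\<exists>G :: 'a \<Rightarrow> ennreal.
    is_common_cond_exp P \<Theta> (S t) (\<lambda>\<omega>. enn2ereal (E \<omega>)) (\<lambda>\<omega>. enn2ereal (G \<omega>))"
proof -
  have neg: "e2ennreal (- enn2ereal x) = 0" for x
    by (intro e2ennreal_neg) simp
  have h: "(\<lambda>\<omega>. enn2ereal (E \<omega>)) \<in> borel_measurable (F t)"
    using E by measurable
  have "\<forall>\<theta>\<in>\<Theta>. expect_defined (P \<theta>) (\<lambda>\<omega>. enn2ereal (E \<omega>))"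
    by (simp add: expect_defined_def neg)
  with suff h obtain g where
    g: "is_common_cond_exp P \<Theta> (S t) (\<lambda>\<omega>. enn2ereal (E \<omega>)) g"
    unfolding sufficient_filtration_def by blast
  have gm [measurable]: "g \<in> borel_measurable (S t)"
    using g by (simp add: is_common_cond_exp_def)
  have m: "(\<lambda>\<omega>. enn2ereal (e2ennreal (g \<omega>))) \<in> borel_measurable (S t)"
    by measurable
  have "is_cond_exp (P \<theta>) (S t) (\<lambda>\<omega>. enn2ereal (E \<omega>)) (\<lambda>\<omega>. enn2ereal (e2ennreal (g \<omega>)))"
    if \<theta>: "\<theta> \<in> \<Theta>" for \<theta>
  proof -
    interpret prob_space "P \<theta>" using prob \<theta> by blast
    have sp: "space (P \<theta>) = space M"
      using prob(2)[OF \<theta>] by (rule sets_eq_imp_space_eq)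
    have "subalgebra (P \<theta>) (S t)"
      using suff sub prob(2)[OF \<theta>] sp
      unfolding sufficient_filtration_def subalgebra_def by (metis order_trans)
    then interpret finite_measure_subalgebra "P \<theta>" "S t"
      by unfold_locales
    have zero: "AE \<omega> in P \<theta>. nn_cond_exp (P \<theta>) (S t) (\<lambda>\<omega>. 0) \<omega> = 0"
      using nn_cond_exp_F_meas[of "\<lambda>\<omega>. 0"] by simp
    have "AE \<omega> in P \<theta>. g \<omega> =
        enn2ereal (nn_cond_exp (P \<theta>) (S t) E \<omega>) -
        enn2ereal (nn_cond_exp (P \<theta>) (S t) (\<lambda>\<omega>. 0) \<omega>)"
      using g \<theta> by (simp add: is_common_cond_exp_def is_cond_exp_def neg)
    with zero have "AE \<omega> in P \<theta>. enn2ereal (e2ennreal (g \<omega>)) =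
        enn2ereal (nn_cond_exp (P \<theta>) (S t) E \<omega>) -
        enn2ereal (nn_cond_exp (P \<theta>) (S t) (\<lambda>\<omega>. 0) \<omega>)"
      by eventually_elim (simp add: zero_ennreal.rep_eq)
    with m show ?thesis
      by (simp add: is_cond_exp_def neg)
  qed
  with m show ?thesis
    by (intro exI[of _ "\<lambda>\<omega>. e2ennreal (g \<omega>)"]) (simp add: is_common_cond_exp_def)
qed

end

theory Submission
  imports Defs
begin

text \<open>
  Fix \<open>\<theta>\<close> and an \<open>S\<close>-stopping time \<open>\<tau>\<close>, and put \<open>X = E\<^sub>\<tau>\<close>, \<open>Y = G\<^sub>\<tau>\<close>. Summing over the events
  \<open>\<tau> = t\<close> shows that \<open>\<phi>(Y) X\<close> and \<open>\<phi>(Y) Y\<close> have the same expectation for all measurable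
  \<open>\<phi> \<ge> 0\<close>; all claims depend only on this property. A tangent line bound
  \<open>U \<le> V + a(Y) (X - Y)\<close> is integrated with positive and negative parts distributed over the two
  sides, first on the event that \<open>\<bar>a(Y)\<bar> Y\<close> is bounded and then in the limit; so no
  integrability assumption is needed. Jensen's inequality is the case \<open>U = f(X)\<close>, \<open>V = f(Y)\<close>, and
  the last claim is the case \<open>U = ln (X/Y)\<close>, \<open>V = 0\<close>, \<open>a(y) = 1/y\<close>. Where \<open>Y = \<infinity>\<close> there is no tangent:
  a nondecreasing \<open>f\<close> has \<open>f(X) \<le> f(\<infinity>)\<close>, and any other \<open>f\<close> lies below a falling line, so that the
  negative part of \<open>f(X)\<close> has infinite expectation as soon as \<open>Y\<close>, hence \<open>X\<close>, does.
\<close>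

section \<open>Pairs whose second entry is a conditional mean of the first\<close>

text \<open>With indicators for \<phi>, \<open>balance\<close> says that \<open>Y\<close> is a
  version of the conditional expectation of \<open>X\<close> given the \<sigma>-algebra generated by
  \<open>Y\<close>. This makes sense for infinite expectations too.\<close>

locale conditional_mean = prob_space N for N :: "'a measure" +
  fixes X Y :: "'a \<Rightarrow> ennreal"
  assumes measurable_X [measurable]: "X \<in> borel_measurable N"
    and measurable_Y [measurable]: "Y \<in> borel_measurable N"
    and balance: "\<And>\<phi>. \<phi> \<in> borel_measurable borel \<Longrightarrow>
      (\<integral>\<^sup>+\<omega>. \<phi> (Y \<omega>) * X \<omega> \<partial>N) = (\<integral>\<^sup>+\<omega>. \<phi> (Y \<omega>) * Y \<omega> \<partial>N)"
begin

lemma nn_integral_X_eq_Y: "(\<integral>\<^sup>+\<omega>. X \<omega> \<partial>N) = (\<integral>\<^sup>+\<omega>. Y \<omega> \<partial>N)"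
  using balance[of "\<lambda>_. 1"] by simp

text \<open>Testing with the indicator of \<open>{0}\<close> shows that \<open>X\<close> has
  integral \<open>0\<close> on the event \<open>Y = 0\<close>. This settles the endpoint
  \<open>0\<close>, at which a concave \<open>f\<close> may have no tangent.\<close>

lemma AE_X_eq_0: "AE \<omega> in N. Y \<omega> = 0 \<longrightarrow> X \<omega> = 0"
proof -
  have "(\<integral>\<^sup>+\<omega>. indicator {0} (Y \<omega>) * X \<omega> \<partial>N) = (\<integral>\<^sup>+\<omega>. indicator {0} (Y \<omega>) * Y \<omega> \<partial>N)"
    by (rule balance) measurable
  also have "\<dots> = (\<integral>\<^sup>+\<omega>. 0 \<partial>N)"
    by (intro nn_integral_cong) (simp split: split_indicator)
  finally have "AE \<omega> in N. indicator {0} (Y \<omega>) * X \<omega> = 0"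
    by (subst nn_integral_0_iff_AE[symmetric]) auto
  then show ?thesis
    by eventually_elim (auto split: split_indicator_asm)
qed

text \<open>On \<open>Y \<le> n\<close> balance bounds the integral of \<open>X\<close> by
  \<open>n\<close>, and countably many such events cover \<open>Y < \<infinity>\<close>.\<close>

lemma AE_X_finite: "AE \<omega> in N. Y \<omega> \<noteq> \<infinity> \<longrightarrow> X \<omega> \<noteq> \<infinity>"
proof -
  have "AE \<omega> in N. indicator {..of_nat n} (Y \<omega>) * X \<omega> \<noteq> \<infinity>" for n
  proof (rule nn_integral_noteq_infinite)
    have "(\<integral>\<^sup>+\<omega>. indicator {..of_nat n} (Y \<omega>) * X \<omega> \<partial>N)
        = (\<integral>\<^sup>+\<omega>. indicator {..of_nat n} (Y \<omega>) * Y \<omega> \<partial>N)"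
      by (rule balance) measurable
    also have "\<dots> \<le> (\<integral>\<^sup>+\<omega>. of_nat n \<partial>N)"
      by (intro nn_integral_mono) (simp split: split_indicator)
    also have "\<dots> < \<infinity>"
      by (simp add: emeasure_space_1 of_nat_less_top)
    finally show "(\<integral>\<^sup>+\<omega>. indicator {..of_nat n} (Y \<omega>) * X \<omega> \<partial>N) \<noteq> \<infinity>"
      by simp
  qed measurable
  then have "AE \<omega> in N. \<forall>n. indicator {..of_nat n} (Y \<omega>) * X \<omega> \<noteq> \<infinity>"
    by (simp add: AE_all_countable)
  then show ?thesis
  proof eventually_elim
    case (elim \<omega>)
    show ?case
    proof
      assume "Y \<omega> \<noteq> \<infinity>"
      then obtain n where "Y \<omega> < of_nat n"
        using ennreal_Ex_less_of_nat[of "Y \<omega>"] by (auto simp: top.not_eq_extremum)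
      with elim show "X \<omega> \<noteq> \<infinity>"
        by (auto split: split_indicator_asm dest!: spec[of _ n])
    qed
  qed
qed

text \<open>\<open>c\<close> and \<open>d\<close> stand for the positive and negative part of a
  slope. By balance their terms have the same integrals on both sides, so they cancel wherever these
  are finite. The events \<open>Y \<in> B n\<close> ensure this, and monotone convergence removes
  the restriction.\<close>

lemma nn_integral_le_of_balanced:
  assumes [measurable]: "L \<in> borel_measurable N" "R \<in> borel_measurable N"
    and [measurable]: "c \<in> borel_measurable borel" "d \<in> borel_measurable borel"
    and fin: "\<And>y. c y * y < \<infinity>" "\<And>y. d y * y < \<infinity>"
    and le: "AE \<omega> in N. L \<omega> + c (Y \<omega>) * Y \<omega> + d (Y \<omega>) * X \<omega>
      \<le> R \<omega> + c (Y \<omega>) * X \<omega> + d (Y \<omega>) * Y \<omega>"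
  shows "(\<integral>\<^sup>+\<omega>. L \<omega> \<partial>N) \<le> (\<integral>\<^sup>+\<omega>. R \<omega> \<partial>N)"
proof -
  \<comment> \<open>\<open>B n\<close> restricts \<open>Y\<close> alone, so its indicator can be
    absorbed into the test function of \<open>balance\<close>.\<close>
  define B where "B n = {y. c y * y \<le> of_nat n \<and> d y * y \<le> of_nat n}" for n :: nat
  have B [measurable]: "B n \<in> sets borel" for n
    unfolding B_def by measurable
  have bounded_part: "(\<integral>\<^sup>+\<omega>. indicator (B n) (Y \<omega>) * L \<omega> \<partial>N) \<le> (\<integral>\<^sup>+\<omega>. R \<omega> \<partial>N)" for n
  proof -
    let ?I = "\<lambda>h. \<integral>\<^sup>+\<omega>. indicator (B n) (Y \<omega>) * h \<omega> \<partial>N"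
    have swap: "?I (\<lambda>\<omega>. e (Y \<omega>) * X \<omega>) = ?I (\<lambda>\<omega>. e (Y \<omega>) * Y \<omega>)"
      if [measurable]: "e \<in> borel_measurable borel" for e
      using balance[of "\<lambda>y. indicator (B n) y * e y"] by (simp add: mult.assoc)
    have small: "?I (\<lambda>\<omega>. e (Y \<omega>) * Y \<omega>) \<noteq> \<infinity>"
      if "\<And>y. y \<in> B n \<Longrightarrow> e y * y \<le> of_nat n" for e
    proof -
      have "?I (\<lambda>\<omega>. e (Y \<omega>) * Y \<omega>) \<le> (\<integral>\<^sup>+\<omega>. of_nat n \<partial>N)"
        using that by (intro nn_integral_mono) (simp split: split_indicator)
      also have "\<dots> < \<infinity>"
        by (simp add: emeasure_space_1 of_nat_less_top)
      finally show ?thesis by simp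
    qed
    have "?I (\<lambda>\<omega>. L \<omega> + c (Y \<omega>) * Y \<omega> + d (Y \<omega>) * X \<omega>)
        \<le> ?I (\<lambda>\<omega>. R \<omega> + c (Y \<omega>) * X \<omega> + d (Y \<omega>) * Y \<omega>)"
      using le by (intro nn_integral_mono_AE) (auto split: split_indicator elim: eventually_mono)
    then have "?I L + ?I (\<lambda>\<omega>. c (Y \<omega>) * Y \<omega>) + ?I (\<lambda>\<omega>. d (Y \<omega>) * X \<omega>)
        \<le> ?I R + ?I (\<lambda>\<omega>. c (Y \<omega>) * X \<omega>) + ?I (\<lambda>\<omega>. d (Y \<omega>) * Y \<omega>)"
      by (simp add: distrib_left nn_integral_add)
    then have "(?I (\<lambda>\<omega>. c (Y \<omega>) * Y \<omega>) + ?I (\<lambda>\<omega>. d (Y \<omega>) * Y \<omega>)) + ?I L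
        \<le> (?I (\<lambda>\<omega>. c (Y \<omega>) * Y \<omega>) + ?I (\<lambda>\<omega>. d (Y \<omega>) * Y \<omega>)) + ?I R"
      by (simp add: swap add_ac)
    moreover have "?I (\<lambda>\<omega>. c (Y \<omega>) * Y \<omega>) \<noteq> \<infinity>" "?I (\<lambda>\<omega>. d (Y \<omega>) * Y \<omega>) \<noteq> \<infinity>"
      by (intro small; simp add: B_def)+
    ultimately have "?I L \<le> ?I R"
      by (simp only: ennreal_add_left_cancel_le) (simp add: ennreal_add_eq_top)
    \<comment> \<open>\<open>R\<close> is replaced by its full integral at once; the limit in
      \<open>n\<close> is taken for \<open>L\<close> only.\<close>
    also have "\<dots> \<le> (\<integral>\<^sup>+\<omega>. R \<omega> \<partial>N)"
      by (intro nn_integral_mono) (simp split: split_indicator)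
    finally show ?thesis .
  qed
  have mono: "incseq (\<lambda>n \<omega>. indicator (B n) (Y \<omega>) * L \<omega>)"
  proof (intro incseq_SucI le_funI)
    fix n \<omega>
    have "B n \<subseteq> B (Suc n)"
      by (auto simp: B_def intro: order_trans[where y="of_nat n"])
    then show "indicator (B n) (Y \<omega>) * L \<omega> \<le> indicator (B (Suc n)) (Y \<omega>) * L \<omega>"
      by (auto split: split_indicator)
  qed
  have exhaust: "(SUP n. indicator (B n) (Y \<omega>) * L \<omega>) = L \<omega>" for \<omega>
  proof (rule antisym)
    show "(SUP n. indicator (B n) (Y \<omega>) * L \<omega>) \<le> L \<omega>"
      by (intro SUP_least) (simp split: split_indicator)
    have "max (c (Y \<omega>) * Y \<omega>) (d (Y \<omega>) * Y \<omega>) \<noteq> \<infinity>"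
      using fin by (simp add: max_def less_top)
    then obtain n where "max (c (Y \<omega>) * Y \<omega>) (d (Y \<omega>) * Y \<omega>) < of_nat n"
      using ennreal_Ex_less_of_nat by (metis infinity_ennreal_def top.not_eq_extremum)
    then have "Y \<omega> \<in> B n"
      by (simp add: B_def less_imp_le)
    then show "L \<omega> \<le> (SUP n. indicator (B n) (Y \<omega>) * L \<omega>)"
      by (intro SUP_upper2[of n]) auto
  qed
  have "(\<integral>\<^sup>+\<omega>. L \<omega> \<partial>N) = (\<integral>\<^sup>+\<omega>. (SUP n. indicator (B n) (Y \<omega>) * L \<omega>) \<partial>N)"
    by (simp add: exhaust)
  also have "\<dots> = (SUP n. \<integral>\<^sup>+\<omega>. indicator (B n) (Y \<omega>) * L \<omega> \<partial>N)"
    by (rule nn_integral_monotone_convergence_SUP[OF mono]) measurable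
  also have "\<dots> \<le> (\<integral>\<^sup>+\<omega>. R \<omega> \<partial>N)"
    by (intro SUP_least bounded_part)
  finally show ?thesis .
qed

end

section \<open>Tangent line inequalities in terms of positive and negative parts\<close>

text \<open>\<open>ennreal\<close> truncates at \<open>0\<close>, so \<open>ennreal q\<close> and
  \<open>ennreal (- q)\<close> are the two parts of \<open>q\<close>. Moving each negative part
  across leaves sums of nonnegative terms, which can be integrated unconditionally.\<close>

lemma ennreal_parts_le_of_real_le:
  fixes q p a r y :: real
  assumes le: "q \<le> p + a * (r - y)" and nonneg: "0 \<le> r" "0 \<le> y"
  shows "ennreal q + ennreal (- p) + ennreal a * ennreal y + ennreal (- a) * ennreal r
    \<le> ennreal p + ennreal (- q) + ennreal a * ennreal r + ennreal (- a) * ennreal y"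
proof -
  \<comment> \<open>The same truncation inside the reals, where subtraction and linear arithmetic
    are available.\<close>
  define pos :: "real \<Rightarrow> real" where "pos x = max 0 x" for x
  have pos_nonneg [simp]: "0 \<le> pos x" and ennreal_pos: "ennreal x = ennreal (pos x)"
    and pos_diff: "pos x - pos (- x) = x" for x
    by (auto simp: pos_def max_def ennreal_neg)
  have "(pos a - pos (- a)) * (r - y) = a * (r - y)"
    by (simp add: pos_diff)
  then have "pos a * r + pos (- a) * y - (pos a * y + pos (- a) * r) = a * (r - y)"
    by (simp add: algebra_simps)
  then have "pos q + pos (- p) + pos a * y + pos (- a) * r
      \<le> pos p + pos (- q) + pos a * r + pos (- a) * y"
    using le pos_diff[of p] pos_diff[of q] by linarith
  then show ?thesis
    using nonneg
    by (simp add: ennreal_pos[of q] ennreal_pos[of "- p"] ennreal_pos[of a] ennreal_pos[of "- a"]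
        ennreal_pos[of p] ennreal_pos[of "- q"]
        ennreal_mult[symmetric] ennreal_plus[symmetric] ennreal_leI del: ennreal_plus)
qed

lemma e2ennreal_parts_mono:
  assumes "u \<le> v"
  shows "e2ennreal u + e2ennreal (- v) \<le> e2ennreal v + e2ennreal (- u)"
  using assms by (intro add_mono e2ennreal_mono) auto

text \<open>Finiteness of \<open>v\<close> excludes \<open>u = \<infinity>\<close>, and
  \<open>u = - \<infinity>\<close> makes the right-hand side infinite; the real case
  remains.\<close>

lemma e2ennreal_parts_le_of_ereal_le:
  fixes u v :: ereal and a r y :: real
  assumes le: "u \<le> v + ereal (a * (r - y))" and fin: "\<bar>v\<bar> \<noteq> \<infinity>" and nonneg: "0 \<le> r" "0 \<le> y"
  shows "e2ennreal u + e2ennreal (- v) + ennreal a * ennreal y + ennreal (- a) * ennreal r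
    \<le> e2ennreal v + e2ennreal (- u) + ennreal a * ennreal r + ennreal (- a) * ennreal y"
proof -
  obtain p where p: "v = ereal p"
    using fin by auto
  show ?thesis
  proof (cases u)
    case (real q)
    then show ?thesis
      using ennreal_parts_le_of_real_le[of q p a r y] le nonneg p by simp
  qed (use le p in \<open>auto simp: e2ennreal_infty\<close>)
qed

section \<open>The integrated tangent bound and the logarithm of the ratio\<close>

context conditional_mean
begin

text \<open>This compares the expectations of \<open>U\<close> and \<open>V\<close> with negative
  parts moved across, which stays meaningful when an expectation is undefined. \<open>U\<close> and
  \<open>V\<close> are abstract so as to cover both utilities and the log ratio.\<close>

lemma tangent_bound:
  fixes U V :: "'a \<Rightarrow> ereal" and a :: "real \<Rightarrow> real"
  assumes [measurable]: "U \<in> borel_measurable N" "V \<in> borel_measurable N"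
    and [measurable]: "a \<in> borel_measurable borel"
    and infinite: "AE \<omega> in N. Y \<omega> = \<infinity> \<longrightarrow> U \<omega> \<le> V \<omega>"
    and zero: "\<And>\<omega>. X \<omega> = 0 \<Longrightarrow> Y \<omega> = 0 \<Longrightarrow> U \<omega> \<le> V \<omega>"
    and tangent: "\<And>\<omega> r y. 0 \<le> r \<Longrightarrow> 0 < y \<Longrightarrow> X \<omega> = ennreal r \<Longrightarrow> Y \<omega> = ennreal y \<Longrightarrow>
      \<bar>V \<omega>\<bar> \<noteq> \<infinity> \<and> U \<omega> \<le> V \<omega> + ereal (a y * (r - y))"
  shows "(\<integral>\<^sup>+\<omega>. e2ennreal (U \<omega>) \<partial>N) + (\<integral>\<^sup>+\<omega>. e2ennreal (- V \<omega>) \<partial>N)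
    \<le> (\<integral>\<^sup>+\<omega>. e2ennreal (V \<omega>) \<partial>N) + (\<integral>\<^sup>+\<omega>. e2ennreal (- U \<omega>) \<partial>N)"
proof -
  \<comment> \<open>The value \<open>0\<close> at \<open>\<infinity>\<close> keeps
    \<open>c y * y\<close> and \<open>d y * y\<close> finite, since
    \<open>0 * \<infinity> = 0\<close>; there the bound reduces to \<open>U \<le> V\<close>.\<close>
  define c where "c y = (if y = \<infinity> then 0 else ennreal (a (enn2real y)))" for y
  define d where "d y = (if y = \<infinity> then 0 else ennreal (- a (enn2real y)))" for y
  have [measurable]: "c \<in> borel_measurable borel" "d \<in> borel_measurable borel"
    unfolding c_def d_def by measurable
  have fin: "c y * y < \<infinity>" "d y * y < \<infinity>" for y
    by (auto simp: c_def d_def ennreal_mult_less_top less_top)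
  have "AE \<omega> in N. e2ennreal (U \<omega>) + e2ennreal (- V \<omega>) + c (Y \<omega>) * Y \<omega> + d (Y \<omega>) * X \<omega>
      \<le> e2ennreal (V \<omega>) + e2ennreal (- U \<omega>) + c (Y \<omega>) * X \<omega> + d (Y \<omega>) * Y \<omega>"
    using infinite AE_X_eq_0 AE_X_finite
  proof eventually_elim
    case (elim \<omega>)
    show ?case
    proof (cases "Y \<omega>")
      case top
      with elim show ?thesis
        using e2ennreal_parts_mono by (simp add: c_def d_def)
    next
      case (real y)
      show ?thesis
      proof (cases "y = 0")
        case True
        with elim real zero[of \<omega>] show ?thesis
          using e2ennreal_parts_mono by simp
      next
        case False
        obtain r where r: "0 \<le> r" "X \<omega> = ennreal r"
          using elim real by (cases "X \<omega>") auto
        with tangent[of r y \<omega>] real False show ?thesis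
          using e2ennreal_parts_le_of_ereal_le[of "U \<omega>" "V \<omega>" "a y" r y]
          by (simp add: c_def d_def)
      qed
    qed
  qed
  from nn_integral_le_of_balanced[OF _ _ _ _ fin this] show ?thesis
    by (simp add: nn_integral_add)
qed

text \<open>The tangent bound compares the two parts but does not make the expectation defined. For
  that, the positive part is dominated by \<open>X / Y\<close> on
  \<open>0 < Y < \<infinity>\<close>, whose integral is at most \<open>1\<close> by balance with
  weight \<open>1 / Y\<close>.\<close>

lemma log_ratio_expect_le_0:
  "expect_defined N (\<lambda>\<omega>. ext_ln (e_ratio (X \<omega>) (Y \<omega>)))" (is ?defined)
  "expect N (\<lambda>\<omega>. ext_ln (e_ratio (X \<omega>) (Y \<omega>))) \<le> 0" (is ?le)
proof -
  let ?U = "\<lambda>\<omega>. ext_ln (e_ratio (X \<omega>) (Y \<omega>))"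
  have [measurable]: "ext_ln \<in> borel_measurable borel"
    unfolding ext_ln_def by measurable
  have [measurable]: "?U \<in> borel_measurable N"
    unfolding e_ratio_def by measurable
  have ln_bound: "?U \<omega> \<le> ereal (1 / y * (r - y))"
    if "0 \<le> r" "0 < y" "X \<omega> = ennreal r" "Y \<omega> = ennreal y" for \<omega> r y
  proof -
    have *: "e_ratio (X \<omega>) (Y \<omega>) = ennreal (r / y)"
      using that by (simp add: e_ratio_def divide_ennreal)
    show ?thesis
    proof (cases "r = 0")
      case False
      then have "ln (r / y) \<le> r / y - 1"
        using that by (intro ln_le_minus_one) auto
      also have "\<dots> = 1 / y * (r - y)"
        using that by (simp add: field_simps)
      finally show ?thesis
        unfolding * using that False by (simp add: ext_ln_def)
    qed (simp add: * ext_ln_def)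
  qed
  \<comment> \<open>By the conventions for ratios, \<open>e_ratio\<close> is \<open>1\<close> or
    \<open>0\<close> here, according to whether \<open>X\<close> is infinite.\<close>
  have at_infinity: "?U \<omega> \<le> 0" if "Y \<omega> = \<infinity>" for \<omega>
    using that by (auto simp: e_ratio_def ext_ln_def zero_ereal_def)
  have at_zero: "?U \<omega> \<le> 0" if "X \<omega> = 0" "Y \<omega> = 0" for \<omega>
    using that by (auto simp: e_ratio_def ext_ln_def)
  have le: "(\<integral>\<^sup>+\<omega>. e2ennreal (?U \<omega>) \<partial>N) \<le> (\<integral>\<^sup>+\<omega>. e2ennreal (- ?U \<omega>) \<partial>N)"
    using tangent_bound[of ?U "\<lambda>_. 0" "\<lambda>y. 1 / y"] ln_bound at_infinity at_zero
    by simp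
  define c :: "ennreal \<Rightarrow> ennreal" where "c y = (if y = \<infinity> \<or> y = 0 then 0 else 1 / y)" for y
  have [measurable]: "c \<in> borel_measurable borel"
    unfolding c_def by measurable
  have "AE \<omega> in N. e2ennreal (?U \<omega>) \<le> c (Y \<omega>) * X \<omega>"
    using AE_X_eq_0 AE_X_finite
  proof eventually_elim
    case (elim \<omega>)
    show ?case
    proof (cases "Y \<omega> = \<infinity> \<or> Y \<omega> = 0")
      case True
      then have "?U \<omega> \<le> 0"
        using at_infinity[of \<omega>] at_zero[of \<omega>] elim by blast
      then show ?thesis
        by (simp add: e2ennreal_neg)
    next
      case False
      then obtain y where y: "0 < y" "Y \<omega> = ennreal y"
        by (cases "Y \<omega>") (auto simp: less_le)
      obtain r where r: "0 \<le> r" "X \<omega> = ennreal r"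
        using elim False by (cases "X \<omega>") auto
      have "1 / y * (r - y) \<le> r / y"
        using y by (simp add: field_simps)
      with ln_bound[OF r(1) y(1) r(2) y(2)] have "?U \<omega> \<le> ereal (r / y)"
        by (meson ereal_less_eq(3) order_trans)
      then have "e2ennreal (?U \<omega>) \<le> ennreal (r / y)"
        by (metis e2ennreal_mono e2ennreal_ereal)
      also have "\<dots> = c (Y \<omega>) * X \<omega>"
        using r y
        by (simp add: c_def divide_ennreal ennreal_1[symmetric] ennreal_mult[symmetric]
            del: ennreal_1)
      finally show ?thesis .
    qed
  qed
  then have "(\<integral>\<^sup>+\<omega>. e2ennreal (?U \<omega>) \<partial>N) \<le> (\<integral>\<^sup>+\<omega>. c (Y \<omega>) * X \<omega> \<partial>N)"
    by (rule nn_integral_mono_AE)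
  also have "\<dots> = (\<integral>\<^sup>+\<omega>. c (Y \<omega>) * Y \<omega> \<partial>N)"
    by (rule balance) measurable
  also have "\<dots> \<le> (\<integral>\<^sup>+\<omega>. 1 \<partial>N)"
    by (intro nn_integral_mono) (auto simp: c_def ennreal_divide_times ennreal_divide_self less_top)
  also have "\<dots> < \<infinity>"
    by (simp add: emeasure_space_1 of_nat_less_top)
  finally have fin: "(\<integral>\<^sup>+\<omega>. e2ennreal (?U \<omega>) \<partial>N) < \<infinity>" .
  then show ?defined
    by (simp add: expect_defined_def)
  \<comment> \<open>Finiteness matters again: in \<open>ereal\<close> the difference
    \<open>\<infinity> - \<infinity>\<close> is \<open>\<infinity>\<close>.\<close>
  from fin le show ?le
    unfolding expect_def
    by (intro ereal_minus_le_iff[THEN iffD2]) (auto simp: less_eq_ennreal.rep_eq)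
qed

end

section \<open>Concave utilities and their extension to \<open>[0,\<infinity>]\<close>\<close>

text \<open>Supporting lines of the convex function \<open>- f\<close> give the slopes pointwise.
  Any choice of slopes is nonincreasing, hence Borel.\<close>

lemma concave_on_supergradient:
  fixes f :: "real \<Rightarrow> real"
  assumes "concave_on {0<..} f"
  obtains a where "a \<in> borel_measurable borel"
    "\<And>x y. 0 < x \<Longrightarrow> 0 < y \<Longrightarrow> f y \<le> f x + a x * (y - x)"
proof -
  have "\<exists>b. \<forall>y>0. f y \<le> f x + b * (y - x)" if "0 < x" for x
  proof -
    have "x \<in> interior {0<..}"
      using that by (simp add: interior_open)
    from convex_le_Inf_differential[OF assms[unfolded concave_on_def] this]
    obtain m where "\<And>y. 0 < y \<Longrightarrow> - f y \<ge> - f x + m * (y - x)"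
      by (metis greaterThan_iff)
    then show ?thesis
      by (intro exI[of _ "- m"]) (auto simp: algebra_simps)
  qed
  then obtain b where b: "\<And>x y. 0 < x \<Longrightarrow> 0 < y \<Longrightarrow> f y \<le> f x + b x * (y - x)"
    by metis
  have "b y \<le> b x" if "0 < x" "x \<le> y" for x y
  proof (cases "x = y")
    case False
    \<comment> \<open>The sum of the tangent inequalities at \<open>x\<close> and at
      \<open>y\<close>.\<close>
    have "0 \<le> (b x - b y) * (y - x)"
      using b[of x y] b[of y x] that by (simp add: algebra_simps)
    then show ?thesis
      using that False by (simp add: zero_le_mult_iff)
  qed simp
  then have "mono_on {0<..} (\<lambda>x. - b x)"
    by (auto intro: mono_onI)
  from borel_measurable_uminus[OF borel_measurable_mono_on_fnc[OF this]]
  have "b \<in> borel_measurable (restrict_space borel {0<..})"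
    by simp
  then have "(\<lambda>x. if x \<in> {0<..} then b x else 0) \<in> borel_measurable borel"
    by (subst measurable_If_restrict_space_iff) (auto simp: greaterThan_def)
  from that[OF this] b show ?thesis
    by simp
qed

lemma extend_utility_ennreal [simp]: "0 < x \<Longrightarrow> extend_utility f (ennreal x) = ereal (f x)"
  by (simp add: extend_utility_def)

lemma extend_utility_0: "extend_utility f 0 = Lim (at_right 0) (\<lambda>r. ereal (f r))"
  by (simp add: extend_utility_def)

lemma extend_utility_top: "extend_utility f \<infinity> = Lim at_top (\<lambda>r. ereal (f r))"
  by (simp add: extend_utility_def)

lemma borel_measurable_extend_utility:
  assumes "concave_on {0<..} f"
  shows "extend_utility f \<in> borel_measurable borel"
proof -
  have "continuous_on {0<..} (\<lambda>x. - f x)"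
    using assms unfolding concave_on_def by (intro convex_on_continuous) auto
  from continuous_on_minus[OF this] have "continuous_on {0<..} f"
    by simp
  then have [measurable]: "(\<lambda>x. if x \<in> {0<..} then f x else 0) \<in> borel_measurable borel"
    by (intro borel_measurable_continuous_on_if) auto
  \<comment> \<open>The endpoint values enter as mere constants, so existence of the limits is
    irrelevant for measurability.\<close>
  have "extend_utility f = (\<lambda>x. if x = 0 then extend_utility f 0
      else if x = \<infinity> then extend_utility f \<infinity>
      else ereal (if enn2real x \<in> {0<..} then f (enn2real x) else 0))"
    by (auto simp: fun_eq_iff extend_utility_def enn2real_positive_iff less_top zero_less_iff_neq_zero)
  also have "\<dots> \<in> borel_measurable borel"
    by measurable
  finally show ?thesis .
qed

text \<open>\<open>Lim\<close> is usable only once a limit is known to exist. If some slope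
  \<open>a x\<close> is positive, \<open>f\<close> is nondecreasing on \<open>(0, x)\<close>;
  otherwise \<open>f\<close> is nonincreasing throughout. Either way it is monotone near
  \<open>0\<close>.\<close>

lemma concave_on_tendsto_at_right_0:
  assumes f: "concave_on {0<..} f"
  shows "((\<lambda>r. ereal (f r)) \<longlongrightarrow> extend_utility f 0) (at_right 0)"
proof -
  obtain a where a: "\<And>x y. 0 < x \<Longrightarrow> 0 < y \<Longrightarrow> f y \<le> f x + a x * (y - x)"
    using concave_on_supergradient[OF f] by metis
  have "\<exists>l. ((\<lambda>r. ereal (f r)) \<longlongrightarrow> l) (at_right 0)"
  proof (cases "\<exists>x>0. 0 < a x")
    case True
    then obtain x where x: "0 < x" "0 < a x" by blast
    have mono: "f u \<le> f v" if "0 < u" "u \<le> v" "v < x" for u v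
    proof -
      have "0 \<le> (a v - a x) * (x - v)"
        using a[of v x] a[of x v] that x by (simp add: algebra_simps)
      then have "0 < a v"
        using that x by (simp add: zero_le_mult_iff)
      then have "a v * (u - v) \<le> 0"
        using that by (intro mult_nonneg_nonpos) auto
      with a[of v u] that show ?thesis by simp
    qed
    have "((\<lambda>r. ereal (f r)) \<longlongrightarrow> Inf ((\<lambda>r. ereal (f r)) ` ({0<..} \<inter> {..<x})))
        (at 0 within ({0<..} \<inter> {..<x}))"
      by (rule Lim_right_bound[where K="-\<infinity>"]) (auto intro: mono)
    moreover have "at 0 within ({0<..} \<inter> {..<x}) = at_right 0"
      using x by (intro at_within_nhd[where S="{..<x}"]) auto
    ultimately show ?thesis by auto
  next
    case False
    have anti: "f v \<le> f u" if "0 < u" "u \<le> v" for u v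
    proof -
      have "a u * (v - u) \<le> 0"
        using that False by (intro mult_nonpos_nonneg) (meson not_less, simp)
      with a[of u v] that show ?thesis by simp
    qed
    have "((\<lambda>r. - ereal (f r)) \<longlongrightarrow> Inf ((\<lambda>r. - ereal (f r)) ` ({0<..} \<inter> UNIV)))
        (at 0 within ({0<..} \<inter> UNIV))"
      by (rule Lim_right_bound[where K="-\<infinity>"]) (auto intro: anti)
    then have "((\<lambda>r. - (- ereal (f r))) \<longlongrightarrow> - Inf ((\<lambda>r. - ereal (f r)) ` ({0<..} \<inter> UNIV)))
        (at_right 0)"
      by (intro tendsto_uminus_ereal) simp
    then show ?thesis by auto
  qed
  then show ?thesis
    unfolding extend_utility_0 using tendsto_Lim trivial_limit_at_right_real by metis
qed

lemma extend_utility_0_le: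
  assumes f: "concave_on {0<..} f" and le: "\<And>x. 0 < x \<Longrightarrow> f x \<le> p + b * x"
  shows "extend_utility f 0 \<le> ereal p"
proof -
  have "((\<lambda>r. p + b * r) \<longlongrightarrow> p + b * 0) (at_right 0)"
    by (intro tendsto_intros)
  then have "((\<lambda>r. ereal (p + b * r)) \<longlongrightarrow> ereal p) (at_right 0)"
    by simp
  moreover have "\<forall>\<^sub>F r in at_right 0. ereal (f r) \<le> ereal (p + b * r)"
    using le by (intro eventually_at_rightI[of 0 1]) auto
  ultimately show ?thesis
    by (intro tendsto_le[OF trivial_limit_at_right_real _ concave_on_tendsto_at_right_0[OF f]])
qed

text \<open>The majorant is an arbitrary affine function because it serves both for tangents and,
  with \<open>y = 0\<close>, for a falling line.\<close>

lemma extend_utility_tangent: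
  assumes f: "concave_on {0<..} f" and le: "\<And>x. 0 < x \<Longrightarrow> f x \<le> p + b * (x - y)"
    and r: "0 \<le> r"
  shows "extend_utility f (ennreal r) \<le> ereal p + ereal (b * (r - y))"
proof (cases "r = 0")
  case True
  have "extend_utility f 0 \<le> ereal (p - b * y)"
    using le by (intro extend_utility_0_le[OF f, where b=b]) (auto simp: algebra_simps)
  with True show ?thesis by simp
next
  case False
  with le[of r] r show ?thesis by simp
qed

text \<open>The limit of a nondecreasing \<open>f\<close> at infinity is its supremum. This replaces
  the tangent where \<open>Y = \<infinity>\<close>.\<close>

lemma extend_utility_le_top:
  assumes f: "concave_on {0<..} f" and mono: "mono_on {0<..} f"
  shows "extend_utility f x \<le> extend_utility f \<infinity>"
proof -
  have mono': "f u \<le> f v" if "0 < u" "u \<le> v" for u v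
    using mono_onD[OF mono] that by simp
  have "((\<lambda>r. ereal (f r)) \<longlongrightarrow> (SUP r\<in>{0<..}. ereal (f r))) at_top"
  proof (rule increasing_tendsto)
    show "\<forall>\<^sub>F r in at_top. ereal (f r) \<le> (SUP r\<in>{0<..}. ereal (f r))"
      using eventually_gt_at_top[of 0] by eventually_elim (auto intro: SUP_upper)
    fix l assume "l < (SUP r\<in>{0<..}. ereal (f r))"
    then obtain u where "0 < u" "l < ereal (f u)"
      by (auto simp: less_SUP_iff)
    then show "\<forall>\<^sub>F r in at_top. l < ereal (f r)"
      by (intro eventually_mono[OF eventually_ge_at_top[of u]])
        (meson mono' ereal_less_eq(3) less_le_trans)
  qed
  then have top: "extend_utility f \<infinity> = (SUP r\<in>{0<..}. ereal (f r))"
    unfolding extend_utility_top by (intro tendsto_Lim) auto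
  have upper: "ereal (f r) \<le> extend_utility f \<infinity>" if "0 < r" for r
    unfolding top using that by (auto intro: SUP_upper)
  show ?thesis
  proof (cases x)
    case (real r)
    show ?thesis
    proof (cases "r = 0")
      case True
      have "\<forall>\<^sub>F r in at_right 0. ereal (f r) \<le> extend_utility f \<infinity>"
        using upper by (intro eventually_at_rightI[of 0 1]) auto
      then have "extend_utility f 0 \<le> extend_utility f \<infinity>"
        by (intro tendsto_upperbound[OF concave_on_tendsto_at_right_0[OF f]]) auto
      with real True show ?thesis by simp
    qed (use real upper in simp)
  qed simp
qed

lemma extend_utility_top_eq_minus_infinity:
  assumes le: "\<And>x. 0 < x \<Longrightarrow> f x \<le> p - c * x" and c: "0 < c"
  shows "extend_utility f \<infinity> = - \<infinity>"
proof -
  have "((\<lambda>r. ereal (f r)) \<longlongrightarrow> - \<infinity>) at_top"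
  proof (rule tendsto_MInfty[THEN iffD2], intro allI)
    fix z
    show "\<forall>\<^sub>F r in at_top. ereal (f r) < ereal z"
      \<comment> \<open>Beyond \<open>(p - z) / c\<close> the line \<open>p - c * x\<close> lies
        below \<open>z\<close>.\<close>
      using eventually_gt_at_top[of "max 0 ((p - z) / c)"]
    proof eventually_elim
      case (elim r)
      then have "p - c * r < z"
        using c by (simp add: field_simps)
      with le[of r] elim show ?case by simp
    qed
  qed
  then show ?thesis
    unfolding extend_utility_top by (intro tendsto_Lim) auto
qed

section \<open>Jensen's inequality for extended utilities\<close>

text \<open>Definedness keeps one part of each expectation finite, so the negative parts can be
  moved back without meeting \<open>\<infinity> - \<infinity>\<close>.\<close>

lemma expect_mono_of_parts_le:
  assumes "(\<integral>\<^sup>+\<omega>. e2ennreal (U \<omega>) \<partial>N) + (\<integral>\<^sup>+\<omega>. e2ennreal (- V \<omega>) \<partial>N)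
    \<le> (\<integral>\<^sup>+\<omega>. e2ennreal (V \<omega>) \<partial>N) + (\<integral>\<^sup>+\<omega>. e2ennreal (- U \<omega>) \<partial>N)"
    and "expect_defined N U" "expect_defined N V"
  shows "expect N U \<le> expect N V"
proof -
  have "enn2ereal p - enn2ereal q \<le> enn2ereal p' - enn2ereal q'"
    if "p + q' \<le> p' + q" "p < \<infinity> \<or> q < \<infinity>" "p' < \<infinity> \<or> q' < \<infinity>" for p q p' q' :: ennreal
    using that
    by (cases p; cases q; cases p'; cases q')
      (auto simp: ennreal_plus[symmetric] top_unique simp del: ennreal_plus)
  with assms show ?thesis
    unfolding expect_def expect_defined_def by blast
qed

context conditional_mean
begin

lemma expect_extend_utility_mono:
  assumes f: "concave_on {0<..} f"
    and defined: "expect_defined N (\<lambda>\<omega>. extend_utility f (X \<omega>))"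
      "expect_defined N (\<lambda>\<omega>. extend_utility f (Y \<omega>))"
  shows "expect N (\<lambda>\<omega>. extend_utility f (X \<omega>)) \<le> expect N (\<lambda>\<omega>. extend_utility f (Y \<omega>))"
proof (rule expect_mono_of_parts_le[OF _ defined])
  let ?U = "\<lambda>\<omega>. extend_utility f (X \<omega>)" and ?V = "\<lambda>\<omega>. extend_utility f (Y \<omega>)"
  note [measurable] = borel_measurable_extend_utility[OF f]
  obtain a where a [measurable]: "a \<in> borel_measurable borel"
    and tangent: "\<And>x y. 0 < x \<Longrightarrow> 0 < y \<Longrightarrow> f y \<le> f x + a x * (y - x)"
    using concave_on_supergradient[OF f] by metis
  show "(\<integral>\<^sup>+\<omega>. e2ennreal (?U \<omega>) \<partial>N) + (\<integral>\<^sup>+\<omega>. e2ennreal (- ?V \<omega>) \<partial>N)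
      \<le> (\<integral>\<^sup>+\<omega>. e2ennreal (?V \<omega>) \<partial>N) + (\<integral>\<^sup>+\<omega>. e2ennreal (- ?U \<omega>) \<partial>N)" (is ?goal)
  proof -
    \<comment> \<open>Tangents cover finite positive values of \<open>Y\<close>, and at
      \<open>X = Y = 0\<close> both utilities agree; only \<open>Y = \<infinity>\<close> remains as
      a condition.\<close>
    have from_tangent: ?goal if "AE \<omega> in N. Y \<omega> = \<infinity> \<longrightarrow> ?U \<omega> \<le> ?V \<omega>"
    proof (rule tangent_bound[OF _ _ a that])
      fix \<omega> r y
      assume *: "0 \<le> r" "0 < y" "X \<omega> = ennreal r" "Y \<omega> = ennreal y"
      with extend_utility_tangent[OF f tangent[OF \<open>0 < y\<close>] \<open>0 \<le> r\<close>]
      show "\<bar>?V \<omega>\<bar> \<noteq> \<infinity> \<and> ?U \<omega> \<le> ?V \<omega> + ereal (a y * (r - y))"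
        by simp
    qed simp_all
    show ?goal
    proof (cases "mono_on {0<..} f")
      case True
      then show ?thesis
        by (intro from_tangent AE_I2 impI) (use extend_utility_le_top[OF f True] in simp)
    next
      case False
      then obtain u v where uv: "0 < u" "u \<le> v" "f v < f u"
        by (auto simp: monotone_on_def not_le)
      \<comment> \<open>The drop from \<open>u\<close> to \<open>v\<close> forces a negative slope
        at \<open>v\<close>. The falling line is the tangent there, with slope \<open>- c\<close>
        and intercept \<open>p\<close>.\<close>
      define c where "c = - a v"
      have "a v * (u - v) > 0"
        using tangent[of v u] uv by simp
      then have c: "0 < c"
        using uv by (auto simp: c_def zero_less_mult_iff)
      define p where "p = f v + c * v"
      have line: "f x \<le> p - c * x" if "0 < x" for x
        using tangent[of v x] uv that by (simp add: p_def c_def algebra_simps)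
      show ?thesis
      \<comment> \<open>If \<open>Y\<close> has infinite mean, so has \<open>X\<close>; the falling
        line then makes the negative part of \<open>?U\<close> integrate to
        \<open>\<infinity>\<close>, and the right-hand side is infinite. Otherwise \<open>Y\<close>
        is almost surely finite and tangents suffice.\<close>
      proof (cases "(\<integral>\<^sup>+\<omega>. Y \<omega> \<partial>N) = \<infinity>")
        case True
        have "ennreal c * X \<omega> \<le> e2ennreal (- ?U \<omega>) + ennreal p" for \<omega>
        proof (cases "X \<omega>")
          case top
          then show ?thesis
            using extend_utility_top_eq_minus_infinity[OF line c] by (simp add: e2ennreal_infty)
        next
          case (real r)
          have "f x \<le> p + (- c) * (x - 0)" if "0 < x" for x
            using line[OF that] by simp
          from extend_utility_tangent[OF f this \<open>0 \<le> r\<close>] real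
          have "?U \<omega> \<le> ereal (p - c * r)"
            by simp
          then have "ereal (c * r - p) \<le> - ?U \<omega>"
            using ereal_minus_le_minus[of "ereal (p - c * r)" "?U \<omega>"] by simp
          from e2ennreal_mono[OF this] have *: "ennreal (c * r - p) \<le> e2ennreal (- ?U \<omega>)"
            by simp
          have "ennreal c * X \<omega> = ennreal (c * r - p + p)"
            using c real by (simp add: ennreal_mult)
          \<comment> \<open>Only an inequality, since either summand may be truncated to
            \<open>0\<close>.\<close>
          also have "\<dots> \<le> ennreal (c * r - p) + ennreal p"
            by (auto simp: ennreal_plus_if intro!: ennreal_leI)
          finally show ?thesis
            by (rule order_trans) (rule add_right_mono[OF *])
        qed
        then have "(\<integral>\<^sup>+\<omega>. ennreal c * X \<omega> \<partial>N) \<le> (\<integral>\<^sup>+\<omega>. e2ennreal (- ?U \<omega>) + ennreal p \<partial>N)"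
          by (intro nn_integral_mono)
        then have "(\<integral>\<^sup>+\<omega>. e2ennreal (- ?U \<omega>) \<partial>N) = \<infinity>"
          using True c
          by (simp add: nn_integral_cmult nn_integral_add nn_integral_X_eq_Y emeasure_space_1
              ennreal_mult_top top_unique ennreal_add_eq_top)
        then show ?thesis by simp
      next
        case False
        then have "AE \<omega> in N. Y \<omega> \<noteq> \<infinity>"
          by (intro nn_integral_noteq_infinite) auto
        then show ?thesis
          by (intro from_tangent) (auto elim: eventually_mono)
      qed
    qed
  qed
qed

end

section \<open>Stopping a process and its conditional expectations\<close>

text \<open>On \<open>\<tau> = t\<close> the weight is \<open>\<phi> (G t)\<close>, and its product
  with the indicator of this event is \<open>S t\<close>-measurable. Hence \<open>E t\<close> may be
  replaced by \<open>G t\<close> under the integral, separately for each \<open>t\<close>.\<close>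

lemma conditional_mean_stopped:
  fixes S :: "nat \<Rightarrow> 'a measure" and E G :: "nat \<Rightarrow> 'a \<Rightarrow> ennreal"
  assumes "prob_space N" and filt: "filtration (space N) S"
    and sub: "\<And>t. subalgebra N (S t)"
    and E [measurable]: "\<And>t. E t \<in> borel_measurable N"
    and G: "\<And>t. is_cond_exp N (S t) (\<lambda>\<omega>. enn2ereal (E t \<omega>)) (\<lambda>\<omega>. enn2ereal (G t \<omega>))"
    and \<tau>: "stopping_time S \<tau>"
  shows "conditional_mean N (\<lambda>\<omega>. E (\<tau> \<omega>) \<omega>) (\<lambda>\<omega>. G (\<tau> \<omega>) \<omega>)"
proof -
  interpret prob_space N by fact
  have [measurable]: "(\<lambda>\<omega>. enn2ereal (G t \<omega>)) \<in> borel_measurable (S t)" for t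
    using G by (simp add: is_cond_exp_def)
  have "(\<lambda>\<omega>. e2ennreal (enn2ereal (G t \<omega>))) \<in> borel_measurable (S t)" for t
    by measurable
  then have G_S [measurable]: "G t \<in> borel_measurable (S t)" for t
    by simp
  have G_N [measurable]: "G t \<in> borel_measurable N" for t
    using measurable_from_subalg[OF sub G_S] .
  have ev_S: "{\<omega> \<in> space N. \<tau> \<omega> = t} \<in> sets (S t)" for t
    using \<tau> stopping_time_nat_iff[OF filt] by blast
  then have ev_N: "{\<omega> \<in> space N. \<tau> \<omega> = t} \<in> sets N" for t
    using sub by (auto simp: subalgebra_def)
  then have \<tau>_N [measurable]: "\<tau> \<in> measurable N (count_space UNIV)"
    by (subst measurable_count_space_eq_countable) (auto simp: vimage_def Int_def conj_commute)
  \<comment> \<open>The negative part of \<open>E t\<close> is \<open>0\<close>, so the difference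
    in \<open>is_cond_exp\<close> collapses to the nonnegative conditional expectation.\<close>
  have G_eq: "AE \<omega> in N. G t \<omega> = nn_cond_exp N (S t) (E t) \<omega>" for t
  proof -
    interpret finite_measure_subalgebra N "S t"
      using sub by unfold_locales
    have neg: "e2ennreal (- enn2ereal x) = 0" for x
      by (intro e2ennreal_neg) simp
    have "AE \<omega> in N. nn_cond_exp N (S t) (\<lambda>\<omega>. 0) \<omega> = 0"
      using nn_cond_exp_F_meas[of "\<lambda>\<omega>. 0"] by simp
    moreover have "AE \<omega> in N. enn2ereal (G t \<omega>) = enn2ereal (nn_cond_exp N (S t) (E t) \<omega>)
        - enn2ereal (nn_cond_exp N (S t) (\<lambda>\<omega>. 0) \<omega>)"
      using G[of t] by (simp add: is_cond_exp_def neg)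
    ultimately show ?thesis
      by eventually_elim (simp add: zero_ennreal.rep_eq enn2ereal_inject)
  qed
  show ?thesis
  proof unfold_locales
    show "(\<lambda>\<omega>. E (\<tau> \<omega>) \<omega>) \<in> borel_measurable N" "(\<lambda>\<omega>. G (\<tau> \<omega>) \<omega>) \<in> borel_measurable N"
      by (rule measurable_compose_countable[OF E \<tau>_N] measurable_compose_countable[OF G_N \<tau>_N])+
  next
    fix \<phi> :: "ennreal \<Rightarrow> ennreal" assume [measurable]: "\<phi> \<in> borel_measurable borel"
    let ?w = "\<lambda>t \<omega>. indicator {\<omega> \<in> space N. \<tau> \<omega> = t} \<omega> * \<phi> (G t \<omega>)"
    have w_S: "?w t \<in> borel_measurable (S t)" for t
      using ev_S[of t] by measurable
    have w_N [measurable]: "?w t \<in> borel_measurable N" for t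
      using measurable_from_subalg[OF sub w_S] .
    \<comment> \<open>At each \<omega> the series has a single possibly nonzero term, at
      \<open>t = \<tau> \<omega>\<close>.\<close>
    have split: "(\<integral>\<^sup>+\<omega>. \<phi> (G (\<tau> \<omega>) \<omega>) * Z (\<tau> \<omega>) \<omega> \<partial>N) = (\<Sum>t. \<integral>\<^sup>+\<omega>. ?w t \<omega> * Z t \<omega> \<partial>N)"
      if [measurable]: "\<And>t. Z t \<in> borel_measurable N" for Z
    proof -
      have "(\<Sum>t. ?w t \<omega> * Z t \<omega>) = \<phi> (G (\<tau> \<omega>) \<omega>) * Z (\<tau> \<omega>) \<omega>" if "\<omega> \<in> space N" for \<omega>
        using that by (subst suminf_finite[of "{\<tau> \<omega>}"]) auto
      then have "(\<integral>\<^sup>+\<omega>. \<phi> (G (\<tau> \<omega>) \<omega>) * Z (\<tau> \<omega>) \<omega> \<partial>N) = (\<integral>\<^sup>+\<omega>. (\<Sum>t. ?w t \<omega> * Z t \<omega>) \<partial>N)"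
        by (intro nn_integral_cong) simp
      also have "\<dots> = (\<Sum>t. \<integral>\<^sup>+\<omega>. ?w t \<omega> * Z t \<omega> \<partial>N)"
        by (intro nn_integral_suminf borel_measurable_times_ennreal w_N that)
      finally show ?thesis .
    qed
    have "(\<integral>\<^sup>+\<omega>. ?w t \<omega> * E t \<omega> \<partial>N) = (\<integral>\<^sup>+\<omega>. ?w t \<omega> * G t \<omega> \<partial>N)" for t
    proof -
      interpret finite_measure_subalgebra N "S t"
        using sub by unfold_locales
      have "(\<integral>\<^sup>+\<omega>. ?w t \<omega> * E t \<omega> \<partial>N) = (\<integral>\<^sup>+\<omega>. ?w t \<omega> * nn_cond_exp N (S t) (E t) \<omega> \<partial>N)"
        by (rule nn_cond_exp_intg[symmetric]) (fact w_S E)+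
      also have "\<dots> = (\<integral>\<^sup>+\<omega>. ?w t \<omega> * G t \<omega> \<partial>N)"
        using G_eq[of t] by (intro nn_integral_cong_AE) (auto elim: eventually_mono)
      finally show ?thesis .
    qed
    then show "(\<integral>\<^sup>+\<omega>. \<phi> (G (\<tau> \<omega>) \<omega>) * E (\<tau> \<omega>) \<omega> \<partial>N)
        = (\<integral>\<^sup>+\<omega>. \<phi> (G (\<tau> \<omega>) \<omega>) * G (\<tau> \<omega>) \<omega> \<partial>N)"
      by (simp add: split)
  qed
qed

theorem theorem2p10:
  fixes M :: "'a measure"
    and P :: "'i \<Rightarrow> 'a measure"
    and \<Theta> \<Theta>0 \<Theta>1 :: "'i set"
    and F S :: "nat \<Rightarrow> 'a measure"
    and E G :: "nat \<Rightarrow> 'a \<Rightarrow> ennreal"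
  assumes prob: "\<And>\<theta>. \<theta> \<in> \<Theta> \<Longrightarrow> prob_space (P \<theta>)"
    and sets_P: "\<And>\<theta>. \<theta> \<in> \<Theta> \<Longrightarrow> sets (P \<theta>) = sets M"
    and partition: "\<Theta>0 \<union> \<Theta>1 = \<Theta>" "\<Theta>0 \<inter> \<Theta>1 = {}"
    and filt: "filtration (space M) F" "\<And>t. subalgebra M (F t)"
    and suff: "sufficient_filtration M P \<Theta> F S"
    and eproc: "e_process M P \<Theta>0 F E"
    and G: "\<And>t. is_common_cond_exp P \<Theta> (S t) (\<lambda>\<omega>. enn2ereal (E t \<omega>)) (\<lambda>\<omega>. enn2ereal (G t \<omega>))"
  shows "e_process M P \<Theta>0 S G
    \<and> (\<forall>\<theta>\<in>\<Theta>. \<forall>\<tau> f. stopping_time S \<tau> \<longrightarrow> concave_on {0<..} f \<longrightarrow>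
          expect_defined (P \<theta>) (\<lambda>\<omega>. extend_utility f (G (\<tau> \<omega>) \<omega>)) \<longrightarrow>
          expect_defined (P \<theta>) (\<lambda>\<omega>. extend_utility f (E (\<tau> \<omega>) \<omega>)) \<longrightarrow>
          expect (P \<theta>) (\<lambda>\<omega>. extend_utility f (G (\<tau> \<omega>) \<omega>))
            \<ge> expect (P \<theta>) (\<lambda>\<omega>. extend_utility f (E (\<tau> \<omega>) \<omega>)))
    \<and> (\<forall>\<theta>\<in>\<Theta>. \<forall>\<tau>. stopping_time S \<tau> \<longrightarrow>
          expect_defined (P \<theta>) (\<lambda>\<omega>. ext_ln (e_ratio (E (\<tau> \<omega>) \<omega>) (G (\<tau> \<omega>) \<omega>)))
          \<and> expect (P \<theta>) (\<lambda>\<omega>. ext_ln (e_ratio (E (\<tau> \<omega>) \<omega>) (G (\<tau> \<omega>) \<omega>))) \<le> 0)"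
proof -
  have sub_S: "subalgebra (F t) (S t)" for t
    using suff by (simp add: sufficient_filtration_def)
  have filt_S: "filtration (space M) S"
    using suff by (simp add: sufficient_filtration_def)
  have G_S: "G t \<in> borel_measurable (S t)" for t
  proof -
    have "(\<lambda>\<omega>. enn2ereal (G t \<omega>)) \<in> borel_measurable (S t)"
      using G by (simp add: is_common_cond_exp_def)
    then have "(\<lambda>\<omega>. e2ennreal (enn2ereal (G t \<omega>))) \<in> borel_measurable (S t)"
      by measurable
    then show ?thesis by simp
  qed
  have sub_M: "subalgebra M (S t)" for t
    using sub_S[of t] filt(2)[of t] by (auto simp: subalgebra_def)
  have E_M: "E t \<in> borel_measurable M" for t
    using eproc measurable_from_subalg[OF filt(2)] by (auto simp: e_process_def)
  \<comment> \<open>\<open>G\<close> is one common version for all of \<open>\<Theta>\<close>, so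
    the stopped pair is a conditional mean under the alternative as well as under the null.\<close>
  have stopped: "conditional_mean (P \<theta>) (\<lambda>\<omega>. E (\<tau> \<omega>) \<omega>) (\<lambda>\<omega>. G (\<tau> \<omega>) \<omega>)"
    if "\<theta> \<in> \<Theta>" "stopping_time S \<tau>" for \<theta> \<tau>
  proof -
    have sets: "sets (P \<theta>) = sets M" and space: "space (P \<theta>) = space M"
      using sets_P[OF that(1)] by (auto dest: sets_eq_imp_space_eq)
    show ?thesis
    proof (rule conditional_mean_stopped[OF prob[OF that(1)] _ _ _ _ that(2)])
      show "filtration (space (P \<theta>)) S"
        using filt_S by (simp add: space)
      show "subalgebra (P \<theta>) (S t)" for t
        using sub_M[of t] by (simp add: subalgebra_def sets space)
      show "E t \<in> borel_measurable (P \<theta>)" for t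
        using E_M[of t] by (simp cong: measurable_cong_sets add: sets)
      show "is_cond_exp (P \<theta>) (S t) (\<lambda>\<omega>. enn2ereal (E t \<omega>)) (\<lambda>\<omega>. enn2ereal (G t \<omega>))" for t
        using G that(1) by (simp add: is_common_cond_exp_def)
    qed
  qed
  have "e_variable M P \<Theta>0 (\<lambda>\<omega>. G (\<tau> \<omega>) \<omega>)" if \<tau>: "stopping_time S \<tau>" for \<tau>
    unfolding e_variable_def
  proof (intro conjI ballI)
    have ev: "{\<omega> \<in> space M. \<tau> \<omega> = t} \<in> sets (S t)" for t
      using \<tau> stopping_time_nat_iff[OF filt_S] by blast
    then have \<tau>_M: "\<tau> \<in> measurable M (count_space UNIV)"
      using sub_M
      by (subst measurable_count_space_eq_countable)
        (auto simp: vimage_def Int_def conj_commute subalgebra_def)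
    show "(\<lambda>\<omega>. G (\<tau> \<omega>) \<omega>) \<in> borel_measurable M"
      by (rule measurable_compose_countable[OF measurable_from_subalg[OF sub_M G_S] \<tau>_M])
    \<comment> \<open>As \<open>S t\<close> is contained in \<open>F t\<close>, the e-process
      property of \<open>E\<close> applies at \<tau>; equality of means then carries the bound
      \<open>1\<close> over to \<open>G\<close>.\<close>
    have "stopping_time F \<tau>"
      using ev sub_S stopping_time_nat_iff[OF filt(1)] by (auto simp: subalgebra_def)
    then have "e_variable M P \<Theta>0 (\<lambda>\<omega>. E (\<tau> \<omega>) \<omega>)"
      using eproc by (simp add: e_process_def)
    moreover fix \<theta> assume "\<theta> \<in> \<Theta>0"
    ultimately have "(\<integral>\<^sup>+\<omega>. E (\<tau> \<omega>) \<omega> \<partial>P \<theta>) \<le> 1"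
      by (simp add: e_variable_def)
    then show "(\<integral>\<^sup>+\<omega>. G (\<tau> \<omega>) \<omega> \<partial>P \<theta>) \<le> 1"
      using conditional_mean.nn_integral_X_eq_Y[OF stopped[OF _ \<tau>]] \<open>\<theta> \<in> \<Theta>0\<close> partition(1) by auto
  qed
  then have "e_process M P \<Theta>0 S G"
    using G_S by (simp add: e_process_def)
  then show ?thesis
    using conditional_mean.expect_extend_utility_mono[OF stopped]
      conditional_mean.log_ratio_expect_le_0[OF stopped] by blast
qed

end
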